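(* Let $Z$ be an Ascoli space. Then $Z$ embeds topologically into a function space $C_k(X,Y)$ for some separable metrizable spaces $X$ and $Y$ if and only if $Z$ is an $\aleph_0$-space.
   Context: All topological spaces are regular $T_1$-spaces. $C_k(X,Y)$ is the set of all continuous functions $X\to Y$ endowed with the compact-open topology, and $C_k(X)=C_k(X,\mathbb R)$. A family $\mathcal N$ of subsets of a space $X$ is a $k$-network if for any open $U\subset X$ and compact $K\subset U$ there is a finite subfamily $\mathcal F\subset\mathcal N$ with $K\subset\bigcup\mathcal F\subset U$. A (regular) space is an $\aleph_0$-space if it has a countable $k$-network. A subset $\mathcal K\subset C_k(X,Y)$ is evenly continuous if the map $(f,x)\mapsto f(x)$ is continuous as a map $\mathcal K\times X\to Y$. A space $X$ is Ascoli if each compact subset of $C_k(X)$ is evenly continuous. *)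

theory Defs
  imports "HOL-Analysis.Analysis"
begin

text \<open>
  A continuous map between abstract topologies is determined only on \<open>topspace X\<close>. As in
  \<^const>\<open>product_topology\<close>, points of the function space are therefore taken to be extensional
  functions, so that maps agreeing on \<open>topspace X\<close> are the same point.
\<close>

definition continuous_functions :: "'a topology \<Rightarrow> 'b topology \<Rightarrow> ('a \<Rightarrow> 'b) set"
  where "continuous_functions X Y = {f \<in> extensional (topspace X). continuous_map X Y f}"

definition compact_open_topology :: "'a topology \<Rightarrow> 'b topology \<Rightarrow> ('a \<Rightarrow> 'b) topology"
  where "compact_open_topology X Y =
    topology_generated_by
      {{f \<in> continuous_functions X Y. f ` K \<subseteq> U} |K U. compactin X K \<and> openin Y U}"

lemma topspace_compact_open_topology [simp]:
  "topspace (compact_open_topology X Y) = continuous_functions X Y"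
proof -
  have "continuous_functions X Y \<in>
      {{f \<in> continuous_functions X Y. f ` K \<subseteq> U} |K U. compactin X K \<and> openin Y U}"
    by (auto intro!: exI[of _ "{}"])
  then show ?thesis
    unfolding compact_open_topology_def topology_generated_by_topspace by blast
qed

definition k_network :: "'a topology \<Rightarrow> 'a set set \<Rightarrow> bool"
  where "k_network X \<N> \<longleftrightarrow>
    (\<forall>N\<in>\<N>. N \<subseteq> topspace X) \<and>
    (\<forall>U K. openin X U \<and> compactin X K \<and> K \<subseteq> U \<longrightarrow>
       (\<exists>\<F>. finite \<F> \<and> \<F> \<subseteq> \<N> \<and> K \<subseteq> \<Union>\<F> \<and> \<Union>\<F> \<subseteq> U))"

definition aleph0_space :: "'a topology \<Rightarrow> bool"
  where "aleph0_space X \<longleftrightarrow>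
    regular_space X \<and> t1_space X \<and> (\<exists>\<N>. countable \<N> \<and> k_network X \<N>)"

definition evenly_continuous :: "'a topology \<Rightarrow> 'b topology \<Rightarrow> ('a \<Rightarrow> 'b) set \<Rightarrow> bool"
  where "evenly_continuous X Y \<K> \<longleftrightarrow>
    continuous_map (prod_topology (subtopology (compact_open_topology X Y) \<K>) X) Y (\<lambda>(f, x). f x)"

definition Ascoli_space :: "'a topology \<Rightarrow> bool"
  where "Ascoli_space X \<longleftrightarrow> regular_space X \<and> t1_space X \<and>
    (\<forall>\<K>. compactin (compact_open_topology X euclideanreal) \<K>
          \<longrightarrow> evenly_continuous X euclideanreal \<K>)"

definition separable_metrizable :: "'a topology \<Rightarrow> bool"
  where "separable_metrizable X \<longleftrightarrow> separable_space X \<and> metrizable_space X"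

definition embeds_in :: "'a topology \<Rightarrow> 'b topology \<Rightarrow> bool"
  where "embeds_in Z W \<longleftrightarrow> (\<exists>e. embedding_map Z W e)"

text \<open>
  HOL cannot quantify existentially over types. An assertion that there exists a separable
  metrizable space is rendered by a topology (with arbitrary carrier) on the type
  \<^typ>\<open>nat \<Rightarrow> real\<close>: every separable metrizable space is homeomorphic to a subspace of the
  countable power of the real line (Urysohn), hence to one of these. What follows from the
  existence of such spaces is also stated for topologies over arbitrary types.
\<close>

end

theory Submission
  imports Defs
begin

text \<open>
  If \<open>X\<close> and \<open>Y\<close> are second countable, then finite intersections of sets of functions mapping a
  member of a countable base of \<open>X\<close> into a member of a countable base of \<open>Y\<close> (both closed under
  finite unions) form a \<open>k\<close>-network of \<open>C\<^sub>k(X,Y)\<close>, and \<open>k\<close>-networks are inherited by subspaces.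

  Conversely, a countable \<open>k\<close>-network of \<open>Z\<close> gives a countable network of \<open>C\<^sub>k(Z)\<close>, so \<open>C\<^sub>k(Z)\<close> is a
  continuous image \<open>\<phi>(X)\<close> of a subspace \<open>X\<close> of the Cantor cube. The map sending \<open>z\<close> to the
  function \<open>x \<mapsto> \<phi>(x)(z)\<close> from \<open>Z\<close> to \<open>C\<^sub>k(X)\<close> is continuous because compact subsets of \<open>C\<^sub>k(Z)\<close> are
  evenly continuous. It is an embedding because \<open>\<phi>\<close> is onto and \<open>Z\<close>, being regular and Lindelof,
  is completely regular; no compact-covering property of \<open>\<phi>\<close> is needed.
\<close>

section \<open>Sets of maps into a given set, and second countability\<close>

definition maps_into :: "'a topology \<Rightarrow> 'b topology \<Rightarrow> 'a set \<Rightarrow> 'b set \<Rightarrow> ('a \<Rightarrow> 'b) set"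
  where "maps_into X Y A U = {f \<in> continuous_functions X Y. f ` A \<subseteq> U}"

lemma compact_open_topology_eq:
  "compact_open_topology X Y =
    topology_generated_by {maps_into X Y K U |K U. compactin X K \<and> openin Y U}"
  by (simp add: compact_open_topology_def maps_into_def)

lemma openin_maps_into:
  "compactin X K \<Longrightarrow> openin Y U \<Longrightarrow> openin (compact_open_topology X Y) (maps_into X Y K U)"
  unfolding compact_open_topology_eq by (rule topology_generated_by_Basis) blast

lemma maps_into_mono:
  "K \<subseteq> P \<Longrightarrow> Q \<subseteq> U \<Longrightarrow> maps_into X Y P Q \<subseteq> maps_into X Y K U"
  by (auto simp: maps_into_def)

lemma separable_metrizable_imp_second_countable:
  assumes "separable_metrizable X"
  shows "second_countable X"
proof -
  obtain M d where "Metric_space M d" and X: "X = Metric_space.mtopology M d"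
    using assms unfolding separable_metrizable_def metrizable_space_def by blast
  then interpret Metric_space M d by simp
  obtain C where C: "countable C" "C \<subseteq> M" "mtopology closure_of C = M"
    using assms unfolding separable_metrizable_def separable_space_def X by auto
  define \<B> where "\<B> = (\<lambda>(c, n). mball c (1 / Suc n)) ` (C \<times> (UNIV :: nat set))"
  have "\<exists>V\<in>\<B>. x \<in> V \<and> V \<subseteq> U" if U: "openin mtopology U" "x \<in> U" for U x
  proof -
    obtain r where r: "r > 0" "mball x r \<subseteq> U" "x \<in> M"
      using U openin_mtopology by blast
    obtain n :: nat where n: "1 / Suc n < r / 2"
      using r(1) nat_approx_posE[of "r / 2"] by auto
    have "x \<in> mtopology closure_of C"
      using C(3) r(3) by simp
    then have "\<forall>e>0. \<exists>c\<in>C. c \<in> mball x e"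
      unfolding metric_closure_of by blast
    moreover have "1 / Suc n > (0 :: real)"
      by simp
    ultimately obtain c where c: "c \<in> C" "c \<in> mball x (1 / Suc n)"
      by blast
    have "mball c (1 / Suc n) \<subseteq> mball x r"
    proof
      fix y assume "y \<in> mball c (1 / Suc n)"
      then have "y \<in> M" "c \<in> M" "d x c < 1 / Suc n" "d c y < 1 / Suc n"
        using c by auto
      then show "y \<in> mball x r"
        using triangle[of x c y] n r(3) by auto
    qed
    moreover have "x \<in> mball c (1 / Suc n)"
      using c commute[of x c] by auto
    moreover have "mball c (1 / Suc n) \<in> \<B>"
      using c(1) unfolding \<B>_def by (auto intro: image_eqI[of _ _ "(c, n)"])
    ultimately show ?thesis
      using r(2) by blast
  qed
  moreover have "countable \<B>" "\<forall>V\<in>\<B>. openin mtopology V"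
    using C(1) unfolding \<B>_def by auto
  ultimately show ?thesis
    unfolding second_countable_def X by blast
qed

section \<open>Countable outer bases for compact sets\<close>

text \<open>Closure under finite unions lets the finitely many members produced by compactness of a
  family of maps be merged into a single one.\<close>

definition compact_outer_base :: "'a topology \<Rightarrow> 'a set set \<Rightarrow> bool"
  where "compact_outer_base X \<Q> \<longleftrightarrow> countable \<Q> \<and> (\<forall>Q\<in>\<Q>. openin X Q) \<and>
    (\<forall>\<F>. finite \<F> \<and> \<F> \<subseteq> \<Q> \<longrightarrow> \<Union>\<F> \<in> \<Q>) \<and>
    (\<forall>K U. compactin X K \<and> openin X U \<and> K \<subseteq> U \<longrightarrow> (\<exists>Q\<in>\<Q>. K \<subseteq> Q \<and> Q \<subseteq> U))"

lemma compact_outer_base_exists: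
  assumes "second_countable X"
  obtains \<Q> where "compact_outer_base X \<Q>"
proof -
  obtain \<B> where B: "countable \<B>" "\<And>V. V \<in> \<B> \<Longrightarrow> openin X V"
      "\<And>U x. openin X U \<Longrightarrow> x \<in> U \<Longrightarrow> \<exists>V\<in>\<B>. x \<in> V \<and> V \<subseteq> U"
    using assms unfolding second_countable_def by metis
  \<comment> \<open>Base members inside \<open>U\<close> cover a compact \<open>K\<close>, and
    finitely many of them suffice; so finite unions are exactly what is needed, and there are
    countably many.\<close>
  define \<Q> where "\<Q> = Union ` {\<F>. finite \<F> \<and> \<F> \<subseteq> \<B>}"
  have "countable \<Q>"
    unfolding \<Q>_def using countable_Collect_finite_subset[OF B(1)]
    by simp
  moreover have "openin X Q" if "Q \<in> \<Q>" for Q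
    using that B(2) unfolding \<Q>_def by blast
  moreover have "\<Union>\<F> \<in> \<Q>" if F: "finite \<F>" "\<F> \<subseteq> \<Q>" for \<F>
  proof -
    have "\<forall>Q\<in>\<F>. \<exists>\<G>. \<G> \<subseteq> \<B> \<and> finite \<G> \<and> Q = \<Union>\<G>"
      using F(2) unfolding \<Q>_def by blast
    then obtain G where G: "\<forall>Q\<in>\<F>. G Q \<subseteq> \<B> \<and> finite (G Q) \<and> Q = \<Union>(G Q)"
      unfolding bchoice_iff by blast
    then have "\<Union>\<F> = (\<Union>Q\<in>\<F>. \<Union>(G Q))"
      by simp
    also have "\<dots> = \<Union>(\<Union>(G ` \<F>))"
      by blast
    finally have "\<Union>\<F> = \<Union>(\<Union>(G ` \<F>))" .
    moreover have "\<Union>(G ` \<F>) \<subseteq> \<B>" "finite (\<Union>(G ` \<F>))"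
      using G F(1) by auto
    ultimately show ?thesis
      unfolding \<Q>_def by blast
  qed
  moreover have "\<exists>Q\<in>\<Q>. K \<subseteq> Q \<and> Q \<subseteq> U" if KU: "compactin X K" "openin X U" "K \<subseteq> U" for K U
  proof -
    define \<U> where "\<U> = {V\<in>\<B>. V \<subseteq> U}"
    have "K \<subseteq> \<Union>\<U>"
      using B(3)[OF KU(2)] KU(3) unfolding \<U>_def by blast
    then obtain \<F> where "finite \<F>" "\<F> \<subseteq> \<U>" "K \<subseteq> \<Union>\<F>"
      using compactinD[OF KU(1), of \<U>] B(2) unfolding \<U>_def by blast
    then show ?thesis
      unfolding \<Q>_def \<U>_def by (intro bexI[of _ "\<Union>\<F>"]) auto
  qed
  ultimately have "compact_outer_base X \<Q>"
    unfolding compact_outer_base_def by simp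
  then show ?thesis
    using that by blast
qed

lemma compact_outer_base_interpolate:
  assumes "compact_outer_base X \<Q>" "compactin X K" "openin X U" "K \<subseteq> U"
  obtains Q where "Q \<in> \<Q>" "openin X Q" "K \<subseteq> Q" "Q \<subseteq> U"
  using assms unfolding compact_outer_base_def by meson

section \<open>Interpolation for compact families of maps\<close>

text \<open>A finite subfamily covering \<open>K\<close> has an open union, which therefore contains
  almost all terms of the sequence. The finitely many others need only finitely many further
  sets.\<close>

lemma compactin_Un_sequence:
  assumes K: "compactin X K" and x: "\<And>n. x n \<in> topspace X"
    and lim: "\<And>W. openin X W \<Longrightarrow> K \<subseteq> W \<Longrightarrow> \<exists>m. \<forall>n\<ge>m. x n \<in> W"
  shows "compactin X (K \<union> x ` {m::nat..})"
  unfolding compactin_def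
proof (intro conjI allI impI)
  show "K \<union> x ` {m..} \<subseteq> topspace X"
    using compactin_subset_topspace[OF K] x by blast
next
  fix \<U> assume U: "(\<forall>U\<in>\<U>. openin X U) \<and> K \<union> x ` {m..} \<subseteq> \<Union>\<U>"
  then obtain \<F> where F: "finite \<F>" "\<F> \<subseteq> \<U>" "K \<subseteq> \<Union>\<F>"
    using compactinD[OF K, of \<U>] by blast
  have "openin X (\<Union>\<F>)"
    using U F by blast
  then obtain k where k: "\<And>n. n \<ge> k \<Longrightarrow> x n \<in> \<Union>\<F>"
    using lim[OF _ F(3)] by blast
  have "compactin X (x ` {m..<k})"
    using x by (intro finite_imp_compactin) auto
  moreover have "x ` {m..<k} \<subseteq> \<Union>\<U>"
    using U by auto
  ultimately obtain \<G> where G: "finite \<G>" "\<G> \<subseteq> \<U>" "x ` {m..<k} \<subseteq> \<Union>\<G>"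
    using compactinD[of X "x ` {m..<k}" \<U>] U by blast
  have "x n \<in> \<Union>(\<F> \<union> \<G>)" if "n \<ge> m" for n
    using k[of n] G(3) that by (cases "n \<ge> k") (auto simp: image_subset_iff)
  then have "K \<union> x ` {m..} \<subseteq> \<Union>(\<F> \<union> \<G>)"
    using F(3) by blast
  then show "\<exists>\<F>. finite \<F> \<and> \<F> \<subseteq> \<U> \<and> K \<union> x ` {m..} \<subseteq> \<Union>\<F>"
    using F G by (intro exI[of _ "\<F> \<union> \<G>"]) auto
qed

text \<open>If no neighbourhood worked, there would be points \<open>x n\<close> converging to \<open>K\<close> and functions
  \<open>f n\<close> in \<open>\<K>\<close> with \<open>f n (x n)\<close> outside \<open>U\<close>. But the open sets of functions mapping a tail
  \<open>K \<union> {x n, x (n+1), \<dots>}\<close>, which is compact, into \<open>U\<close> cover \<open>\<K>\<close>.\<close>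

lemma maps_into_compact_nbhd:
  assumes X: "second_countable X" and KK: "compactin (compact_open_topology X Y) \<K>"
    and K: "compactin X K" and U: "openin Y U" and sub: "\<K> \<subseteq> maps_into X Y K U"
  shows "\<exists>V. openin X V \<and> K \<subseteq> V \<and> \<K> \<subseteq> maps_into X Y V U"
proof (rule ccontr)
  assume no: "\<not> ?thesis"
  obtain \<Q> where Q: "compact_outer_base X \<Q>"
    using compact_outer_base_exists[OF X] .
  define \<P> where "\<P> = {Q\<in>\<Q>. K \<subseteq> Q}"
  obtain Q0 where "Q0 \<in> \<Q>" "K \<subseteq> Q0"
    using compact_outer_base_interpolate[OF Q K openin_topspace compactin_subset_topspace[OF K]]
    by metis
  then have ne: "\<P> \<noteq> {}"
    unfolding \<P>_def by blast
  have cP: "countable \<P>"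
    using Q unfolding compact_outer_base_def \<P>_def by simp
  \<comment> \<open>The enumeration may repeat members of \<open>\<P>\<close> but hits each of them.
    Taking \<open>x n\<close> in \<open>q 0\<close>, ..., \<open>q n\<close> puts a tail of the
    sequence inside every \<open>q i\<close>, hence inside every open set around
    \<open>K\<close>.\<close>
  define q where "q = from_nat_into \<P>"
  have q: "openin X (q i)" "K \<subseteq> q i" for i
    using from_nat_into[OF ne, of i] Q unfolding q_def \<P>_def compact_outer_base_def by auto
  have "\<exists>f x. f \<in> \<K> \<and> x \<in> (\<Inter>i\<le>n. q i) \<and> f x \<notin> U" for n :: nat
  proof -
    have "openin X (\<Inter>i\<in>{..n}. q i)"
      using q by (intro openin_INT2) auto
    then have "\<not> \<K> \<subseteq> maps_into X Y (\<Inter>i\<le>n. q i) U"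
      using no q by blast
    then show ?thesis
      using sub unfolding maps_into_def by blast
  qed
  then obtain f x where fx: "\<And>n. f n \<in> \<K>" "\<And>n i. i \<le> n \<Longrightarrow> x n \<in> q i" "\<And>n::nat. f n (x n) \<notin> U"
    unfolding INT_iff by (metis atMost_iff)
  have xX: "x n \<in> topspace X" for n
    using fx(2)[of 0 n] openin_subset[OF q(1)[of 0]] by blast
  have lim: "\<exists>m. \<forall>n\<ge>m. x n \<in> W" if W: "openin X W" "K \<subseteq> W" for W
  proof -
    obtain Q1 where "Q1 \<in> \<Q>" "K \<subseteq> Q1" "Q1 \<subseteq> W"
      using compact_outer_base_interpolate[OF Q K W] by metis
    then obtain i where "q i \<subseteq> W"
      using from_nat_into_surj[OF cP, of Q1] unfolding q_def \<P>_def by blast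
    then show ?thesis
      using fx(2) by blast
  qed
  define T where "T m = maps_into X Y (K \<union> x ` {m..}) U" for m
  have "openin (compact_open_topology X Y) (T m)" for m
    unfolding T_def using compactin_Un_sequence[OF K xX lim] U by (intro openin_maps_into)
  moreover have "\<K> \<subseteq> \<Union>(range T)"
  proof
    fix g assume g: "g \<in> \<K>"
    then have gc: "g \<in> continuous_functions X Y" "g ` K \<subseteq> U"
      using sub unfolding maps_into_def by auto
    then have "openin X {x \<in> topspace X. g x \<in> U}"
      using U unfolding continuous_functions_def by (auto intro: openin_continuous_map_preimage)
    then obtain m where "\<forall>n\<ge>m. g (x n) \<in> U"
      using lim[of "{x \<in> topspace X. g x \<in> U}"] gc(2) compactin_subset_topspace[OF K] by blast
    then have "g \<in> T m"
      using gc unfolding T_def maps_into_def by auto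
    then show "g \<in> \<Union>(range T)"
      by blast
  qed
  ultimately obtain \<F> where F: "finite \<F>" "\<F> \<subseteq> range T" "\<K> \<subseteq> \<Union>\<F>"
    using compactinD[OF KK, of "range T"] by blast
  then obtain I where I: "finite I" "\<F> = T ` I"
    by (meson finite_subset_image)
  \<comment> \<open>\<open>N\<close> bounds all indices of the finite subcover, so
    \<open>x N\<close> belongs to each of its tails, whichever \<open>T i\<close> contains
    \<open>f N\<close>.\<close>
  obtain N where N: "\<And>i. i \<in> I \<Longrightarrow> i \<le> N"
    using I(1) by (meson finite_nat_set_iff_bounded_le)
  obtain i where "i \<in> I" "f N \<in> T i"
    using fx(1)[of N] F(3) I(2) by blast
  then have "f N (x N) \<in> U"
    using N unfolding T_def maps_into_def by auto
  then show False
    using fx(3) by blast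
qed

text \<open>First \<open>U\<close> is shrunk: each image of \<open>K\<close> is compact and fits
  into some member of \<open>\<Q>\<close> inside \<open>U\<close>, and by compactness of
  \<open>\<K>\<close> one finite union serves all maps. Then \<open>K\<close> is enlarged to a
  neighbourhood that all of \<open>\<K>\<close> maps into that union, and \<open>P\<close> is
  squeezed in between.\<close>

lemma maps_into_compact_interpolation:
  assumes X: "second_countable X" and P: "compact_outer_base X \<P>" and Q: "compact_outer_base Y \<Q>"
    and KK: "compactin (compact_open_topology X Y) \<K>"
    and K: "compactin X K" and U: "openin Y U" and sub: "\<K> \<subseteq> maps_into X Y K U"
  shows "\<exists>P\<in>\<P>. \<exists>Q\<in>\<Q>. \<K> \<subseteq> maps_into X Y P Q \<and> maps_into X Y P Q \<subseteq> maps_into X Y K U"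
proof -
  define \<Q>' where "\<Q>' = {Q\<in>\<Q>. Q \<subseteq> U}"
  have "\<K> \<subseteq> \<Union>(maps_into X Y K ` \<Q>')"
  proof
    fix f assume "f \<in> \<K>"
    then have f: "f \<in> continuous_functions X Y" "f ` K \<subseteq> U"
      using sub unfolding maps_into_def by auto
    then have "compactin Y (f ` K)"
      using image_compactin[OF K] unfolding continuous_functions_def by blast
    then obtain Q where "Q \<in> \<Q>" "f ` K \<subseteq> Q" "Q \<subseteq> U"
      using compact_outer_base_interpolate[OF Q _ U f(2)] by metis
    then show "f \<in> \<Union>(maps_into X Y K ` \<Q>')"
      using f(1) unfolding \<Q>'_def maps_into_def by blast
  qed
  moreover have "openin (compact_open_topology X Y) S" if "S \<in> maps_into X Y K ` \<Q>'" for S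
    using that Q K unfolding \<Q>'_def compact_outer_base_def by (auto intro: openin_maps_into)
  ultimately obtain \<F> where "finite \<F>" "\<F> \<subseteq> maps_into X Y K ` \<Q>'" "\<K> \<subseteq> \<Union>\<F>"
    using compactinD[OF KK, of "maps_into X Y K ` \<Q>'"] by blast
  then obtain \<G> where G: "finite \<G>" "\<G> \<subseteq> \<Q>'" "\<K> \<subseteq> \<Union>(maps_into X Y K ` \<G>)"
    by (metis finite_subset_image)
  then have "\<Union>\<G> \<in> \<Q>" "\<Union>\<G> \<subseteq> U"
    using Q unfolding \<Q>'_def compact_outer_base_def by auto
  moreover have sub': "\<K> \<subseteq> maps_into X Y K (\<Union>\<G>)"
    using G(3) unfolding maps_into_def by fastforce
  moreover have "openin Y (\<Union>\<G>)"
    using Q \<open>\<Union>\<G> \<in> \<Q>\<close> unfolding compact_outer_base_def by blast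
  then obtain V where V: "openin X V" "K \<subseteq> V" "\<K> \<subseteq> maps_into X Y V (\<Union>\<G>)"
    using maps_into_compact_nbhd[OF X KK K _ sub'] by blast
  moreover obtain P where "P \<in> \<P>" "K \<subseteq> P" "P \<subseteq> V"
    using compact_outer_base_interpolate[OF P K V(1,2)] .
  moreover have "\<K> \<subseteq> maps_into X Y P (\<Union>\<G>)"
    using V(3) maps_into_mono[OF \<open>P \<subseteq> V\<close> order_refl] by (rule order_trans)
  moreover have "maps_into X Y P (\<Union>\<G>) \<subseteq> maps_into X Y K U"
    using \<open>K \<subseteq> P\<close> \<open>\<Union>\<G> \<subseteq> U\<close> by (rule maps_into_mono)
  ultimately show ?thesis
    by blast
qed

section \<open>From a subbase to a k-network\<close>

text \<open>As a compact Hausdorff space, \<open>K\<close> is regular, so each point has a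
  relatively closed, hence compact, neighbourhood in \<open>K\<close> inside one member of the
  cover. Finitely many of these cover \<open>K\<close>.\<close>

lemma compact_split_open_cover:
  assumes H: "Hausdorff_space W" and K: "compactin W K"
    and U: "\<And>U. U \<in> \<U> \<Longrightarrow> openin W U" "K \<subseteq> \<Union>\<U>"
  obtains \<C> where "finite \<C>" "K \<subseteq> \<Union>\<C>"
    "\<And>C. C \<in> \<C> \<Longrightarrow> compactin W C \<and> (\<exists>U\<in>\<U>. C \<subseteq> U)"
proof -
  let ?S = "subtopology W K"
  have top: "topspace ?S = K"
    using compactin_subset_topspace[OF K] by auto
  have cS: "compact_space ?S"
    using K compactin_subspace by blast
  have "regular_space ?S"
    using cS H by (intro compact_Hausdorff_imp_regular_space Hausdorff_space_subtopology)
  then have nb: "neighbourhood_base_of (closedin ?S) ?S"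
    using neighbourhood_base_of_closedin by blast
  have "\<exists>V C. openin ?S V \<and> x \<in> V \<and> V \<subseteq> C \<and> closedin ?S C \<and> (\<exists>U\<in>\<U>. C \<subseteq> U)"
    if x: "x \<in> K" for x
  proof -
    obtain U0 where U0: "U0 \<in> \<U>" "x \<in> U0"
      using x U(2) by blast
    have "openin ?S (K \<inter> U0)"
      using U(1)[OF U0(1)] openin_subtopology_Int2 by blast
    then show ?thesis
      using nb U0 x unfolding neighbourhood_base_of by (metis IntI le_inf_iff)
  qed
  then obtain V C where VC: "\<And>x. x \<in> K \<Longrightarrow> openin ?S (V x) \<and> x \<in> V x \<and> V x \<subseteq> C x \<and>
      closedin ?S (C x) \<and> (\<exists>U\<in>\<U>. C x \<subseteq> U)"
    by metis
  have "compactin ?S K"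
    using cS top unfolding compact_space_def by simp
  then obtain \<F> where "finite \<F>" "\<F> \<subseteq> V ` K" "K \<subseteq> \<Union>\<F>"
    using compactinD[of ?S K "V ` K"] VC by blast
  then obtain D where D: "finite D" "D \<subseteq> K" "K \<subseteq> \<Union>(V ` D)"
    by (metis finite_subset_image)
  show ?thesis
  proof
    show "finite (C ` D)" "K \<subseteq> \<Union>(C ` D)"
      using D VC by blast+
    fix C' assume "C' \<in> C ` D"
    then obtain x where "x \<in> K" "C' = C x"
      using D(2) by blast
    then show "compactin W C' \<and> (\<exists>U\<in>\<U>. C' \<subseteq> U)"
      using VC closedin_compact_space[OF cS] compactin_subtopology by blast
  qed
qed

text \<open>Induction on the generation of the open set. For an intersection the two finite families
  are intersected pairwise; for a union \<open>K\<close> is split into finitely many compact pieces,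
  each inside one set of the union. The empty \<open>\<F>\<close> is excluded because its
  intersection is \<open>UNIV\<close>, which may exceed the space.\<close>

lemma k_network_from_subbase:
  fixes \<S> :: "'a set set"
  defines "W \<equiv> topology_generated_by \<S>"
  assumes H: "Hausdorff_space W" and N: "\<And>N. N \<in> \<N> \<Longrightarrow> N \<subseteq> topspace W"
    and base: "\<And>K S. compactin W K \<Longrightarrow> S \<in> \<S> \<Longrightarrow> K \<subseteq> S \<Longrightarrow> \<exists>N\<in>\<N>. K \<subseteq> N \<and> N \<subseteq> S"
  shows "k_network W (Inter ` {\<F>. finite \<F> \<and> \<F> \<subseteq> \<N> \<and> \<F> \<noteq> {}})"
proof -
  define \<M> where "\<M> = Inter ` {\<F>. finite \<F> \<and> \<F> \<subseteq> \<N> \<and> \<F> \<noteq> {}}"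
  have inter: "A \<inter> B \<in> \<M>" if AB: "A \<in> \<M>" "B \<in> \<M>" for A B
  proof -
    obtain \<F> \<G> where FG: "A = \<Inter>\<F>" "B = \<Inter>\<G>"
        "finite \<F> \<and> \<F> \<subseteq> \<N> \<and> \<F> \<noteq> {}" "finite \<G> \<and> \<G> \<subseteq> \<N> \<and> \<G> \<noteq> {}"
      using AB unfolding \<M>_def by blast
    then have "A \<inter> B = \<Inter>(\<F> \<union> \<G>)" by blast
    then show ?thesis
      using FG unfolding \<M>_def by (intro image_eqI[of _ _ "\<F> \<union> \<G>"]) auto
  qed
  have "\<exists>\<F>. finite \<F> \<and> \<F> \<subseteq> \<M> \<and> K \<subseteq> \<Union>\<F> \<and> \<Union>\<F> \<subseteq> U"
    if "generate_topology_on \<S> U" "compactin W K" "K \<subseteq> U" for U K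
    using that
  proof (induction arbitrary: K)
    case Empty
    then show ?case by (intro exI[of _ "{}"]) auto
  next
    case (Int a b)
    obtain \<F> where F: "finite \<F>" "\<F> \<subseteq> \<M>" "K \<subseteq> \<Union>\<F>" "\<Union>\<F> \<subseteq> a"
      using Int.IH(1)[OF Int.prems(1)] Int.prems(2) by auto
    obtain \<G> where G: "finite \<G>" "\<G> \<subseteq> \<M>" "K \<subseteq> \<Union>\<G>" "\<Union>\<G> \<subseteq> b"
      using Int.IH(2)[OF Int.prems(1)] Int.prems(2) by auto
    let ?H = "(\<lambda>(A, B). A \<inter> B) ` (\<F> \<times> \<G>)"
    have "finite ?H"
      using F(1) G(1) by blast
    moreover have "?H \<subseteq> \<M>"
      using F(2) G(2) by (auto intro!: inter)
    moreover have "K \<subseteq> \<Union>?H" "\<Union>?H \<subseteq> a \<inter> b"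
      using F(3,4) G(3,4) by fastforce+
    ultimately show ?case by blast
  next
    case (UN \<U>)
    have "openin W u" if "u \<in> \<U>" for u
      using UN.hyps that unfolding W_def openin_topology_generated_by_iff by blast
    then obtain \<C> where C: "finite \<C>" "K \<subseteq> \<Union>\<C>"
        "\<And>C. C \<in> \<C> \<Longrightarrow> compactin W C \<and> (\<exists>u\<in>\<U>. C \<subseteq> u)"
      using compact_split_open_cover[OF H UN.prems(1) _ UN.prems(2)] by metis
    have "\<exists>\<F>. finite \<F> \<and> \<F> \<subseteq> \<M> \<and> C \<subseteq> \<Union>\<F> \<and> \<Union>\<F> \<subseteq> \<Union>\<U>" if C': "C \<in> \<C>" for C
    proof -
      obtain u where u: "u \<in> \<U>" "C \<subseteq> u" "compactin W C"
        using C(3)[OF C'] by blast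
      show ?thesis
        using UN.IH[OF u(1) u(3) u(2)] u(1) by (meson Sup_upper order_trans)
    qed
    then obtain F where F: "\<And>C. C \<in> \<C> \<Longrightarrow> finite (F C) \<and> F C \<subseteq> \<M> \<and> C \<subseteq> \<Union>(F C) \<and> \<Union>(F C) \<subseteq> \<Union>\<U>"
      by metis
    have "finite (\<Union>(F ` \<C>))" "\<Union>(F ` \<C>) \<subseteq> \<M>"
      using F C(1) by (auto simp: UN_subset_iff)
    moreover have "K \<subseteq> \<Union>(\<Union>(F ` \<C>))"
    proof
      fix x assume "x \<in> K"
      then obtain C where "C \<in> \<C>" "x \<in> C"
        using C(2) by blast
      then show "x \<in> \<Union>(\<Union>(F ` \<C>))"
        using F[of C] by blast
    qed
    moreover have "\<Union>(\<Union>(F ` \<C>)) \<subseteq> \<Union>\<U>"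
    proof -
      have "\<Union>(F C) \<subseteq> \<Union>\<U>" if "C \<in> \<C>" for C
        using F[OF that] by blast
      then show ?thesis
        by blast
    qed
    ultimately show ?case by blast
  next
    case (Basis s)
    then obtain N where "N \<in> \<N>" "K \<subseteq> N" "N \<subseteq> s"
      using base by blast
    moreover from this have "N \<in> \<M>"
      unfolding \<M>_def by (intro image_eqI[of _ _ "{N}"]) auto
    ultimately show ?case
      by (intro exI[of _ "{N}"]) auto
  qed
  moreover have "M \<subseteq> topspace W" if "M \<in> \<M>" for M
    using that N unfolding \<M>_def by blast
  ultimately show ?thesis
    unfolding k_network_def W_def \<M>_def[symmetric] openin_topology_generated_by_iff by auto
qed

section \<open>Countable k-networks of function spaces and of their subspaces\<close>

lemma Hausdorff_space_compact_open_topology: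
  assumes "Hausdorff_space Y"
  shows "Hausdorff_space (compact_open_topology X Y)"
  unfolding Hausdorff_space_def
proof (intro allI impI)
  fix f g
  assume "f \<in> topspace (compact_open_topology X Y) \<and> g \<in> topspace (compact_open_topology X Y) \<and> f \<noteq> g"
  then have fg: "f \<in> continuous_functions X Y" "g \<in> continuous_functions X Y" "f \<noteq> g"
    by auto
  \<comment> \<open>Extensional functions that agree on \<open>topspace X\<close> are equal, so the
    two maps differ at a point of the space; its singleton is compact.\<close>
  then obtain x where x: "x \<in> topspace X" "f x \<noteq> g x"
    unfolding continuous_functions_def by (metis (no_types, lifting) extensionalityI mem_Collect_eq)
  have "f x \<in> topspace Y" "g x \<in> topspace Y"
    using fg x unfolding continuous_functions_def continuous_map_def by auto
  then obtain U V where UV: "openin Y U" "openin Y V" "f x \<in> U" "g x \<in> V" "disjnt U V"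
    using assms x(2) unfolding Hausdorff_space_def by blast
  have "disjnt (maps_into X Y {x} U) (maps_into X Y {x} V)"
    using UV(5) unfolding maps_into_def disjnt_def by auto
  moreover have "f \<in> maps_into X Y {x} U" "g \<in> maps_into X Y {x} V"
    using fg UV unfolding maps_into_def by auto
  moreover have "openin (compact_open_topology X Y) (maps_into X Y {x} U)"
      "openin (compact_open_topology X Y) (maps_into X Y {x} V)"
    using x UV by (auto intro: openin_maps_into)
  ultimately show "\<exists>U V. openin (compact_open_topology X Y) U \<and> openin (compact_open_topology X Y) V \<and>
      f \<in> U \<and> g \<in> V \<and> disjnt U V"
    by blast
qed

lemma compact_open_topology_countable_k_network:
  assumes X: "second_countable X" and Y: "second_countable Y" "Hausdorff_space Y"
  obtains \<N> where "countable \<N>" "k_network (compact_open_topology X Y) \<N>"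
proof -
  obtain \<P> where P: "compact_outer_base X \<P>"
    using compact_outer_base_exists[OF X] .
  obtain \<Q> where Q: "compact_outer_base Y \<Q>"
    using compact_outer_base_exists[OF Y(1)] .
  define \<N> where "\<N> = (\<lambda>(P, Q). maps_into X Y P Q) ` (\<P> \<times> \<Q>)"
  have "\<exists>N\<in>\<N>. \<K> \<subseteq> N \<and> N \<subseteq> S"
    if KK: "compactin (compact_open_topology X Y) \<K>"
      and S: "S \<in> {maps_into X Y K U |K U. compactin X K \<and> openin Y U}" "\<K> \<subseteq> S" for \<K> S
  proof -
    obtain K U where KU: "S = maps_into X Y K U" "compactin X K" "openin Y U"
      using S(1) by blast
    show ?thesis
      using maps_into_compact_interpolation[OF X P Q KK KU(2,3) S(2)[unfolded KU(1)]]
      unfolding KU(1) \<N>_def by auto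
  qed
  moreover have "N \<subseteq> topspace (compact_open_topology X Y)" if "N \<in> \<N>" for N
    using that unfolding \<N>_def maps_into_def by auto
  ultimately have "k_network (compact_open_topology X Y)
      (Inter ` {\<F>. finite \<F> \<and> \<F> \<subseteq> \<N> \<and> \<F> \<noteq> {}})"
    using Hausdorff_space_compact_open_topology[OF Y(2), of X]
    unfolding compact_open_topology_eq by (intro k_network_from_subbase)
  moreover have "countable \<N>"
    using P Q unfolding \<N>_def compact_outer_base_def by auto
  then have "countable {\<F>. finite \<F> \<and> \<F> \<subseteq> \<N>}"
    by (rule countable_Collect_finite_subset)
  then have "countable (Inter ` {\<F>. finite \<F> \<and> \<F> \<subseteq> \<N> \<and> \<F> \<noteq> {}})"
    by (intro countable_image) (erule countable_subset[rotated], blast)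
  ultimately show ?thesis
    using that by blast
qed

text \<open>An open \<open>U\<close> is the preimage of some open \<open>T\<close> in
  \<open>W\<close>, because \<open>e\<close> is injective and open onto its image. A finite family
  between the compact image of \<open>K\<close> and \<open>T\<close> pulls back to one between
  \<open>K\<close> and \<open>U\<close>.\<close>

lemma k_network_embedding_preimage:
  assumes e: "embedding_map Z W e" and N: "k_network W \<N>"
  shows "k_network Z ((\<lambda>N. {z \<in> topspace Z. e z \<in> N}) ` \<N>)"
  unfolding k_network_def
proof (intro conjI ballI allI impI)
  fix U K assume UK: "openin Z U \<and> compactin Z K \<and> K \<subseteq> U"
  let ?E = "subtopology W (e ` topspace Z)"
  have "homeomorphic_map Z ?E e"
    using e unfolding embedding_map_def .
  then have e': "continuous_map Z ?E e" "open_map Z ?E e" "inj_on e (topspace Z)"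
    unfolding homeomorphic_eq_everything_map by blast+
  have "openin ?E (e ` U)"
    using e'(2) UK unfolding open_map_def by blast
  then obtain T where T: "openin W T" "e ` U = T \<inter> e ` topspace Z"
    unfolding openin_subtopology by blast
  have "compactin W (e ` K)"
    using image_compactin[OF _ e'(1)] UK compactin_subtopology by blast
  moreover have "e ` K \<subseteq> T"
    using T(2) UK by blast
  ultimately obtain \<F> where F: "finite \<F>" "\<F> \<subseteq> \<N>" "e ` K \<subseteq> \<Union>\<F>" "\<Union>\<F> \<subseteq> T"
    using N T(1) unfolding k_network_def by meson
  have U: "U \<subseteq> topspace Z"
    using UK openin_subset by blast
  have "z \<in> U" if "z \<in> topspace Z" "e z \<in> T" for z
    using that T(2) e'(3) U by (metis IntI image_eqI inj_on_image_mem_iff)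
  moreover have "\<exists>N\<in>\<F>. e z \<in> N" if "z \<in> K" for z
    using F(3) that by blast
  moreover have "K \<subseteq> topspace Z"
    using UK U by blast
  ultimately show "\<exists>\<F>. finite \<F> \<and> \<F> \<subseteq> (\<lambda>N. {z \<in> topspace Z. e z \<in> N}) ` \<N> \<and> K \<subseteq> \<Union>\<F> \<and> \<Union>\<F> \<subseteq> U"
    using F(1,2,4) by (intro exI[of _ "(\<lambda>N. {z \<in> topspace Z. e z \<in> N}) ` \<F>"]) auto
qed auto

lemma aleph0_space_if_embeds_in_compact_open:
  assumes "regular_space Z" "t1_space Z" "separable_metrizable X" "separable_metrizable Y"
    and "embeds_in Z (compact_open_topology X Y)"
  shows "aleph0_space Z"
proof -
  have "Hausdorff_space Y"
    using assms(4) metrizable_imp_Hausdorff_space unfolding separable_metrizable_def by blast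
  then obtain \<N> where N: "countable \<N>" "k_network (compact_open_topology X Y) \<N>"
    using compact_open_topology_countable_k_network separable_metrizable_imp_second_countable assms
    by metis
  obtain e where "embedding_map Z (compact_open_topology X Y) e"
    using assms(5) unfolding embeds_in_def by blast
  from k_network_embedding_preimage[OF this N(2)] show ?thesis
    using N(1) assms(1,2) unfolding aleph0_space_def by blast
qed

section \<open>Consequences of a countable k-network: complete regularity, and function spaces as
  continuous images\<close>

lemma k_network_pointD:
  assumes "k_network Z \<N>" "openin Z U" "z \<in> U"
  obtains N where "N \<in> \<N>" "z \<in> N" "N \<subseteq> U"
proof -
  have "compactin Z {z}"
    using openin_subset[OF assms(2)] assms(3) by auto
  then obtain \<F> where "\<F> \<subseteq> \<N>" "{z} \<subseteq> \<Union>\<F>" "\<Union>\<F> \<subseteq> U"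
    using assms unfolding k_network_def by (metis empty_subsetI insert_subset)
  then show ?thesis
    using that by blast
qed

text \<open>The network members lying inside some set of the cover already cover the space; choosing
  one such set for each of these countably many members gives the subcover.\<close>

lemma countable_k_network_imp_Lindelof_space:
  assumes N: "countable \<N>" "k_network Z \<N>"
  shows "Lindelof_space Z"
  unfolding Lindelof_space_def
proof (intro allI impI)
  fix \<U> assume U: "(\<forall>U\<in>\<U>. openin Z U) \<and> \<Union>\<U> = topspace Z"
  define \<M> where "\<M> = {N\<in>\<N>. \<exists>U\<in>\<U>. N \<subseteq> U}"
  have "\<forall>N\<in>\<M>. \<exists>U. U \<in> \<U> \<and> N \<subseteq> U"
    unfolding \<M>_def by blast
  then obtain G where G: "\<And>N. N \<in> \<M> \<Longrightarrow> G N \<in> \<U> \<and> N \<subseteq> G N"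
    unfolding bchoice_iff by blast
  have "topspace Z \<subseteq> \<Union>(G ` \<M>)"
  proof
    fix z assume "z \<in> topspace Z"
    then obtain V where V: "V \<in> \<U>" "z \<in> V" "openin Z V"
      using U by blast
    obtain N where "N \<in> \<N>" "z \<in> N" "N \<subseteq> V"
      using k_network_pointD[OF N(2) V(3,2)] .
    then show "z \<in> \<Union>(G ` \<M>)"
      using G V(1) unfolding \<M>_def by blast
  qed
  moreover have "G ` \<M> \<subseteq> \<U>"
    using G by blast
  moreover have "countable (G ` \<M>)"
    using N(1) unfolding \<M>_def by auto
  ultimately show "\<exists>\<V>. countable \<V> \<and> \<V> \<subseteq> \<U> \<and> \<Union>\<V> = topspace Z"
    using U by (intro exI[of _ "G ` \<M>"]) blast
qed

text \<open>This supplies the real functions that separate points from closed sets in the embedding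
  below.\<close>

lemma aleph0_space_imp_completely_regular_space:
  assumes "aleph0_space Z"
  shows "completely_regular_space Z"
  using assms countable_k_network_imp_Lindelof_space regular_Lindelof_imp_normal_space
    normal_imp_completely_regular_space unfolding aleph0_space_def by metis

text \<open>The finite intersections of members of \<open>\<G>\<close> form a network; the members need not be open.\<close>

definition network_subbase :: "'a topology \<Rightarrow> 'a set set \<Rightarrow> bool"
  where "network_subbase C \<G> \<longleftrightarrow>
    (\<forall>U x. openin C U \<and> x \<in> U \<longrightarrow>
      (\<exists>\<F>. finite \<F> \<and> \<F> \<subseteq> \<G> \<and> x \<in> \<Inter>\<F> \<and> topspace C \<inter> \<Inter>\<F> \<subseteq> U))"

text \<open>If \<open>f\<close> maps \<open>K\<close> into \<open>U\<close>, insert \<open>Q\<close>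
  between the image and \<open>U\<close>. Finitely many members of the k-network cover
  \<open>K\<close> inside the preimage of \<open>Q\<close>; the maps sending all of them into
  \<open>Q\<close> include \<open>f\<close> and send \<open>K\<close> into \<open>U\<close>.\<close>

lemma compact_open_topology_network_subbase:
  assumes N: "countable \<N>" "k_network Z \<N>" and Y: "second_countable Y"
  obtains \<G> where "countable \<G>" "network_subbase (compact_open_topology Z Y) \<G>"
proof -
  obtain \<Q> where Q: "compact_outer_base Y \<Q>"
    using compact_outer_base_exists[OF Y] .
  define \<G> where "\<G> = (\<lambda>(N, Q). maps_into Z Y N Q) ` (\<N> \<times> \<Q>)"
  let ?C = "continuous_functions Z Y"
  have "\<exists>\<F>. finite \<F> \<and> \<F> \<subseteq> \<G> \<and> f \<in> \<Inter>\<F> \<and> ?C \<inter> \<Inter>\<F> \<subseteq> W"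
    if "generate_topology_on {maps_into Z Y K U |K U. compactin Z K \<and> openin Y U} W" "f \<in> W" for f W
    using that
  proof induction
    case (Int a b)
    then obtain \<F>1 \<F>2 where "finite \<F>1 \<and> \<F>1 \<subseteq> \<G> \<and> f \<in> \<Inter>\<F>1 \<and> ?C \<inter> \<Inter>\<F>1 \<subseteq> a"
        "finite \<F>2 \<and> \<F>2 \<subseteq> \<G> \<and> f \<in> \<Inter>\<F>2 \<and> ?C \<inter> \<Inter>\<F>2 \<subseteq> b"
      by blast
    then show ?case
      by (intro exI[of _ "\<F>1 \<union> \<F>2"]) auto
  next
    case (UN \<U>)
    then show ?case by (meson Sup_upper Union_iff order_trans)
  next
    case (Basis s)
    then obtain K U where KU: "s = maps_into Z Y K U" "compactin Z K" "openin Y U"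
      by blast
    have f: "f \<in> ?C" "continuous_map Z Y f" "f ` K \<subseteq> U"
      using Basis(2) KU(1) unfolding maps_into_def continuous_functions_def by auto
    obtain Q where Q': "Q \<in> \<Q>" "f ` K \<subseteq> Q" "Q \<subseteq> U" "openin Y Q"
      using compact_outer_base_interpolate[OF Q image_compactin[OF KU(2) f(2)] KU(3) f(3)] by metis
    have "openin Z {z \<in> topspace Z. f z \<in> Q}"
      using openin_continuous_map_preimage[OF f(2) Q'(4)] .
    moreover have "K \<subseteq> {z \<in> topspace Z. f z \<in> Q}"
      using Q'(2) compactin_subset_topspace[OF KU(2)] by blast
    ultimately obtain \<F> where F: "finite \<F>" "\<F> \<subseteq> \<N>" "K \<subseteq> \<Union>\<F>"
        "\<Union>\<F> \<subseteq> {z \<in> topspace Z. f z \<in> Q}"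
      using N(2) KU(2) unfolding k_network_def by meson
    let ?F = "(\<lambda>N. maps_into Z Y N Q) ` \<F>"
    have "finite ?F" "?F \<subseteq> \<G>"
      using F Q'(1) unfolding \<G>_def by auto
    moreover have "f \<in> \<Inter>?F"
      using F(4) f(1) unfolding maps_into_def by blast
    moreover have "?C \<inter> \<Inter>?F \<subseteq> s"
    proof
      fix h assume h: "h \<in> ?C \<inter> \<Inter>?F"
      have "h x \<in> U" if x: "x \<in> K" for x
      proof -
        obtain N where "N \<in> \<F>" "x \<in> N"
          using F(3) x by blast
        then have "h ` N \<subseteq> Q"
          using h unfolding maps_into_def by blast
        then show ?thesis
          using \<open>x \<in> N\<close> Q'(3) by blast
      qed
      then show "h \<in> s"
        using h unfolding KU(1) maps_into_def by blast
    qed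
    ultimately show ?case
      by blast
  qed auto
  then have "network_subbase (compact_open_topology Z Y) \<G>"
    unfolding network_subbase_def topspace_compact_open_topology
    unfolding compact_open_topology_eq openin_topology_generated_by_iff by blast
  moreover have "countable \<G>"
    using N Q unfolding \<G>_def compact_outer_base_def by auto
  ultimately show ?thesis
    using that by blast
qed

lemma second_countable_euclidean:
  "second_countable (euclidean :: 'a::second_countable_topology topology)"
proof -
  obtain \<B> :: "'a set set" where "countable \<B>" "topological_basis \<B>"
    using ex_countable_basis by blast
  then show ?thesis
    unfolding second_countable_def
    by (metis open_openin topological_basisE topological_basis_open)
qed

lemma separable_metrizable_top_of_set:
  "separable_metrizable (top_of_set (S :: (nat \<Rightarrow> real) set))"
  unfolding separable_metrizable_def
  by (intro conjI second_countable_imp_separable_space second_countable_subtopology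
      second_countable_euclidean metrizable_space_subtopology metrizable_space_euclidean)

text \<open>The points of the domain are the membership sequences of points of \<open>C\<close> with respect to an
  enumeration of \<open>\<G>\<close>.\<close>

lemma countable_network_imp_separable_metrizable_image:
  assumes C: "t1_space C" and G: "countable \<G>" "network_subbase C \<G>"
  obtains X :: "(nat \<Rightarrow> real) topology" and \<phi>
  where "separable_metrizable X" "continuous_map X C \<phi>" "\<phi> ` topspace X = topspace C"
proof -
  define g where "g = from_nat_into \<G>"
  define i where "i c = (\<lambda>n. indicator (g n) c :: real)" for c
  \<comment> \<open>Agreement with \<open>c\<close> in finitely many coordinates forces a point into
    \<open>U\<close>. This gives injectivity of \<open>i\<close>, by the T1 axiom, and continuity of
    its inverse; \<open>i\<close> itself is not claimed to be continuous.\<close>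
  have key: "\<exists>I. finite I \<and> (\<forall>d\<in>topspace C. (\<forall>n\<in>I. i d n = i c n) \<longrightarrow> d \<in> U)"
    if U: "openin C U" "c \<in> U" for U c
  proof -
    obtain \<F> where F: "finite \<F>" "\<F> \<subseteq> \<G>" "c \<in> \<Inter>\<F>" "topspace C \<inter> \<Inter>\<F> \<subseteq> U"
      using G(2) U unfolding network_subbase_def by meson
    have "\<F> \<subseteq> range g"
      using F(2) from_nat_into_surj[OF G(1)] unfolding g_def by fast
    then obtain I where I: "finite I" "\<F> = g ` I"
      using F(1) by (meson finite_subset_image)
    have "d \<in> U" if "d \<in> topspace C" "\<forall>n\<in>I. i d n = i c n" for d
    proof -
      have "d \<in> g n" if "n \<in> I" for n
        using F(3) I(2) that \<open>\<forall>n\<in>I. i d n = i c n\<close>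
        unfolding i_def by (auto simp: indicator_def split: if_splits)
      then show ?thesis
        using F(4) I(2) that by blast
    qed
    then show ?thesis
      using I(1) by blast
  qed
  have inj: "inj_on i (topspace C)"
  proof (rule inj_onI, rule ccontr)
    fix c d assume cd: "c \<in> topspace C" "d \<in> topspace C" "i c = i d" "c \<noteq> d"
    then obtain U where "openin C U" "c \<in> U" "d \<notin> U"
      using C unfolding t1_space_def by blast
    then show False
      using key[of U c] cd by auto
  qed
  define X where "X = top_of_set (i ` topspace C)"
  define \<phi> where "\<phi> = inv_into (topspace C) i"
  have phi: "\<phi> (i c) = c" if "c \<in> topspace C" for c
    unfolding \<phi>_def using inj that by simp
  have "continuous_map X C \<phi>"
    unfolding continuous_map_def
  proof (intro conjI allI impI)
    show "\<phi> \<in> topspace X \<rightarrow> topspace C"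
      unfolding X_def using phi by auto
    fix U assume U: "openin C U"
    have "\<exists>T. openin X T \<and> x \<in> T \<and> T \<subseteq> {x \<in> topspace X. \<phi> x \<in> U}"
      if x: "x \<in> topspace X" "\<phi> x \<in> U" for x
    proof -
      obtain c where c: "c \<in> topspace C" "x = i c"
        using x(1) unfolding X_def by auto
      obtain I where I: "finite I" "\<forall>d\<in>topspace C. (\<forall>n\<in>I. i d n = i c n) \<longrightarrow> d \<in> U"
        using key[OF U, of c] x(2) phi c by auto
      \<comment> \<open>The coordinates are 0 or 1, so distance below 1 means equality.\<close>
      define T where "T = (\<Inter>n\<in>I. (\<lambda>y. y n) -` ball (i c n) 1)"
      have "open T"
        unfolding T_def using I(1)
        by (intro open_INT ballI open_vimage continuous_on_product_coordinates) auto
      moreover have "x \<in> T"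
        unfolding T_def c(2) by auto
      moreover have "d \<in> U" if "d \<in> topspace C" "i d \<in> T" for d
      proof -
        have "i d n = i c n" if "n \<in> I" for n
          using \<open>i d \<in> T\<close> that unfolding T_def i_def
          by (auto simp: indicator_def dist_real_def split: if_splits)
        then show ?thesis
          using I(2) \<open>d \<in> topspace C\<close> by blast
      qed
      ultimately show ?thesis
        using x(1) phi unfolding X_def
        by (intro exI[of _ "i ` topspace C \<inter> T"]) auto
    qed
    then show "openin X {x \<in> topspace X. \<phi> x \<in> U}"
      by (subst openin_subopen) blast
  qed
  moreover have "\<phi> ` topspace X = topspace C"
    unfolding X_def using phi by (force simp: image_image)
  ultimately show ?thesis
    using that separable_metrizable_top_of_set unfolding X_def by blast
qed

section \<open>The embedding of an Ascoli space\<close>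

text \<open>The separation condition gives openness onto the image directly. It also gives
  injectivity: applied to a \<open>U\<close> that contains \<open>z\<close> but not
  \<open>w\<close>, it excludes \<open>e z = e w\<close>.\<close>

lemma embedding_mapI:
  assumes Z: "t1_space Z" and e: "continuous_map Z W e"
    and sep: "\<And>U z. openin Z U \<Longrightarrow> z \<in> U \<Longrightarrow>
      \<exists>T. openin W T \<and> e z \<in> T \<and> (\<forall>w\<in>topspace Z. e w \<in> T \<longrightarrow> w \<in> U)"
  shows "embedding_map Z W e"
  unfolding embedding_map_def
proof (rule bijective_open_imp_homeomorphic_map)
  show "continuous_map Z (subtopology W (e ` topspace Z)) e"
    using e by (simp add: continuous_map_in_subtopology)
  show "e ` topspace Z = topspace (subtopology W (e ` topspace Z))"
    using continuous_map_image_subset_topspace[OF e] by auto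
  show "inj_on e (topspace Z)"
  proof (rule inj_onI, rule ccontr)
    fix z w assume zw: "z \<in> topspace Z" "w \<in> topspace Z" "e z = e w" "z \<noteq> w"
    then obtain U where "openin Z U" "z \<in> U" "w \<notin> U"
      using Z unfolding t1_space_def by blast
    then show False
      using sep[of U z] zw by auto
  qed
  show "open_map Z (subtopology W (e ` topspace Z)) e"
    unfolding open_map_def
  proof (intro allI impI)
    fix U assume U: "openin Z U"
    have "\<exists>T. openin (subtopology W (e ` topspace Z)) T \<and> y \<in> T \<and> T \<subseteq> e ` U" if y: "y \<in> e ` U" for y
    proof -
      obtain z where z: "z \<in> U" "y = e z"
        using y by blast
      obtain T where T: "openin W T" "e z \<in> T" "\<forall>w\<in>topspace Z. e w \<in> T \<longrightarrow> w \<in> U"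
        using sep[OF U z(1)] by blast
      have "e z \<in> e ` topspace Z"
        using z openin_subset[OF U] by blast
      then show ?thesis
        using T z(2) openin_subtopology_Int[of W T "e ` topspace Z"]
        by (intro exI[of _ "T \<inter> e ` topspace Z"]) auto
    qed
    then show "openin (subtopology W (e ` topspace Z)) (e ` U)"
      by (subst openin_subopen) blast
  qed
qed

text \<open>This is where even continuity enters. Evaluation is continuous on
  \<open>\<K> \<times> Z\<close>, so the preimage of \<open>U\<close> is open there; when it
  contains \<open>\<K> \<times> {z}\<close>, the tube lemma widens \<open>{z}\<close> to a
  neighbourhood.\<close>

lemma Ascoli_compact_preimage_open:
  assumes Z: "Ascoli_space Z" and KK: "compactin (compact_open_topology Z euclideanreal) \<K>"
    and U: "open U"
  shows "openin Z {z \<in> topspace Z. \<forall>f\<in>\<K>. f z \<in> U}"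
proof -
  let ?S = "subtopology (compact_open_topology Z euclideanreal) \<K>"
  let ?E = "{p \<in> topspace (prod_topology ?S Z). (\<lambda>(f, z). f z) p \<in> U}"
  have "continuous_map (prod_topology ?S Z) euclideanreal (\<lambda>(f, z). f z)"
    using Z KK unfolding Ascoli_space_def evenly_continuous_def by blast
  then have E: "openin (prod_topology ?S Z) ?E"
    using U by (intro openin_continuous_map_preimage) auto
  have S: "topspace ?S = \<K>" "compactin ?S \<K>"
    using compactin_subset_topspace[OF KK] KK by (auto simp: compactin_subtopology)
  have "\<exists>T. openin Z T \<and> z \<in> T \<and> T \<subseteq> {z \<in> topspace Z. \<forall>f\<in>\<K>. f z \<in> U}"
    if z: "z \<in> topspace Z" "\<forall>f\<in>\<K>. f z \<in> U" for z
  proof -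
    have "\<K> \<times> {z} \<subseteq> ?E"
      using z S(1) by (auto simp del: topspace_subtopology)
    then obtain A T where AT: "openin Z T" "\<K> \<subseteq> A" "z \<in> T" "A \<times> T \<subseteq> ?E"
      using tube_lemma_left[OF E S(2) z(1)] by blast
    have "f w \<in> U" if "w \<in> T" "f \<in> \<K>" for f w
    proof -
      have "(f, w) \<in> ?E"
        using AT(2,4) that by blast
      then show ?thesis
        by simp
    qed
    then show ?thesis
      using AT openin_subset[OF AT(1)] by (intro exI[of _ T]) blast
  qed
  then show ?thesis
    by (subst openin_subopen) blast
qed

lemma continuous_map_const_sequence:
  "continuous_map Z (euclidean :: (nat \<Rightarrow> real) topology) (\<lambda>z n. f z)
    \<longleftrightarrow> continuous_map Z euclideanreal f"
  unfolding euclidean_product_topology[symmetric] continuous_map_componentwise_UNIV by auto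

lemma continuous_map_point_evaluation:
  assumes "z \<in> topspace Z"
  shows "continuous_map (compact_open_topology Z Y) Y (\<lambda>f. f z)"
  unfolding continuous_map_def
proof (intro conjI allI impI)
  show "(\<lambda>f. f z) \<in> topspace (compact_open_topology Z Y) \<rightarrow> topspace Y"
    using assms by (auto simp: continuous_functions_def dest: continuous_map_funspace)
  fix U assume "openin Y U"
  then have "openin (compact_open_topology Z Y) (maps_into Z Y {z} U)"
    using assms by (intro openin_maps_into) auto
  then show "openin (compact_open_topology Z Y) {f \<in> topspace (compact_open_topology Z Y). f z \<in> U}"
    by (simp add: maps_into_def)
qed

text \<open>The second space is \<open>\<real>\<^sup>\<nat>\<close> instead of the real line, which sits in it as the constant
  sequences, because its points must have type \<^typ>\<open>nat \<Rightarrow> real\<close>.\<close>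

lemma Ascoli_aleph0_space_embeds_in_compact_open:
  assumes A: "Ascoli_space Z" and N: "aleph0_space Z"
  shows "\<exists>(X :: (nat \<Rightarrow> real) topology) (Y :: (nat \<Rightarrow> real) topology).
    separable_metrizable X \<and> separable_metrizable Y \<and> embeds_in Z (compact_open_topology X Y)"
proof -
  let ?C = "compact_open_topology Z euclideanreal"
  let ?Y = "euclidean :: (nat \<Rightarrow> real) topology"
  have t1: "t1_space ?C"
    by (intro Hausdorff_imp_t1_space Hausdorff_space_compact_open_topology
        metrizable_imp_Hausdorff_space metrizable_space_euclidean)
  have sm: "separable_metrizable (euclidean :: (nat \<Rightarrow> real) topology)"
    using separable_metrizable_top_of_set[of UNIV] by simp
  obtain \<N> where "countable \<N>" "k_network Z \<N>"
    using N unfolding aleph0_space_def by blast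
  then obtain \<G> where "countable \<G>" "network_subbase ?C \<G>"
    using compact_open_topology_network_subbase second_countable_euclidean by metis
  then obtain X :: "(nat \<Rightarrow> real) topology" and \<phi> where X: "separable_metrizable X"
      and phi: "continuous_map X ?C \<phi>" "\<phi> ` topspace X = topspace ?C"
    using countable_network_imp_separable_metrizable_image[OF t1] by metis
  \<comment> \<open>The transpose of \<open>\<phi>\<close>, with each real value turned into a
    constant sequence; the restriction makes \<open>e z\<close> extensional.\<close>
  define e where "e z = restrict (\<lambda>x (n::nat). \<phi> x z) (topspace X)" for z
  have e_in: "e z \<in> continuous_functions X ?Y" if z: "z \<in> topspace Z" for z
  proof -
    have "continuous_map X euclideanreal (\<lambda>x. \<phi> x z)"
      using continuous_map_compose[OF phi(1) continuous_map_point_evaluation[OF z]]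
      by (simp add: o_def)
    then have "continuous_map X ?Y (e z)"
      by (rule continuous_map_eq[OF iffD2[OF continuous_map_const_sequence]]) (simp add: e_def)
    then show ?thesis
      by (simp add: continuous_functions_def e_def)
  qed
  have "continuous_map Z (compact_open_topology X ?Y) e"
    unfolding compact_open_topology_eq continuous_on_generated_topo_iff
  proof (intro conjI allI impI)
    fix S assume "S \<in> {maps_into X ?Y K U |K U. compactin X K \<and> openin ?Y U}"
    then obtain K U where S: "S = maps_into X ?Y K U" "compactin X K" "open U"
      by auto
    have "continuous_on UNIV (\<lambda>r (n::nat). r :: real)"
      by (intro continuous_on_coordinatewise_then_product continuous_on_id)
    then have "open ((\<lambda>r (n::nat). r) -` U)"
      using S(3) by (intro open_vimage)
    \<comment> \<open>The preimage of a subbasic set under \<open>e\<close> is a condition on all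
      \<open>f\<close> in the image of \<open>K\<close> under \<open>\<phi>\<close>, a compact
      subset of \<open>C_k(Z)\<close>, so the previous result on compact families applies.\<close>
    then have "openin Z {z \<in> topspace Z. \<forall>f\<in>\<phi> ` K. f z \<in> (\<lambda>r n. r) -` U}"
      by (intro Ascoli_compact_preimage_open[OF A] image_compactin[OF S(2) phi(1)])
    moreover have "e -` S \<inter> topspace Z = {z \<in> topspace Z. \<forall>f\<in>\<phi> ` K. f z \<in> (\<lambda>r n. r) -` U}"
      using e_in compactin_subset_topspace[OF S(2)]
      unfolding S(1) maps_into_def by (auto simp: e_def image_subset_iff subset_iff)
    ultimately show "openin Z (e -` S \<inter> topspace Z)"
      by simp
  next
    \<comment> \<open>The continuity criterion for a generated topology also asks that the values
      lie in the union of the generators; the generator for the empty compact set is the whole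
      function space.\<close>
    have "compactin X {}" "openin ?Y UNIV"
      by auto
    then have "maps_into X ?Y {} UNIV \<in> {maps_into X ?Y K U |K U. compactin X K \<and> openin ?Y U}"
      by blast
    moreover have "continuous_functions X ?Y = maps_into X ?Y {} UNIV"
      unfolding maps_into_def by simp
    ultimately show "e ` topspace Z \<subseteq> \<Union>{maps_into X ?Y K U |K U. compactin X K \<and> openin ?Y U}"
      using e_in by blast
  qed
  moreover have "\<exists>T. openin (compact_open_topology X ?Y) T \<and> e z \<in> T \<and>
      (\<forall>w\<in>topspace Z. e w \<in> T \<longrightarrow> w \<in> U)" if U: "openin Z U" "z \<in> U" for U z
  proof -
    have zZ: "z \<in> topspace Z"
      using U openin_subset by blast
    obtain f :: "'a \<Rightarrow> real" where f: "continuous_map Z (top_of_set {0..1}) f" "f z = 0"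
        "f ` (topspace Z - U) \<subseteq> {1}"
      using aleph0_space_imp_completely_regular_space[OF N] U zZ
      unfolding completely_regular_space_def by (metis Diff_iff closedin_diff closedin_topspace)
    have "continuous_map Z euclideanreal f"
      using f(1) continuous_map_in_subtopology by blast
    then have "continuous_map Z euclideanreal (restrict f (topspace Z))"
      by (rule continuous_map_eq) simp
    then have "restrict f (topspace Z) \<in> topspace ?C"
      by (simp add: continuous_functions_def)
    \<comment> \<open>Surjectivity of \<open>\<phi>\<close> turns the separating function into a
      point \<open>x\<close>, so the compact set \<open>{x}\<close> alone yields the required
      neighbourhood of \<open>e z\<close>.\<close>
    then obtain x where x: "x \<in> topspace X" "\<phi> x = restrict f (topspace Z)"
      using phi(2) by (metis imageE)
    \<comment> \<open>Coordinate 0 recovers the value from a constant sequence. The bound 1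
      separates the value 0 at \<open>z\<close> from the value 1 outside \<open>U\<close>.\<close>
    define V where "V = {y :: nat \<Rightarrow> real. y 0 < 1}"
    have "open V"
      unfolding V_def
      by (intro open_Collect_less continuous_on_product_coordinates continuous_on_const)
    then have "openin (compact_open_topology X ?Y) (maps_into X ?Y {x} V)"
      using x(1) by (intro openin_maps_into) auto
    moreover have "e z \<in> maps_into X ?Y {x} V"
      using e_in[OF zZ] x zZ f(2) unfolding maps_into_def e_def V_def by auto
    moreover have "w \<in> U" if w: "w \<in> topspace Z" "e w \<in> maps_into X ?Y {x} V" for w
    proof -
      have "f w < 1"
        using w x unfolding maps_into_def e_def V_def by auto
      then show ?thesis
        using f(3) w(1) by fastforce
    qed
    ultimately show ?thesis
      by blast
  qed
  ultimately have "embedding_map Z (compact_open_topology X ?Y) e"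
    using A unfolding Ascoli_space_def by (intro embedding_mapI) auto
  then show ?thesis
    using X sm unfolding embeds_in_def by blast
qed

theorem corollary1p9:
  fixes Z :: "'a topology"
  assumes "Ascoli_space Z"
  shows "((\<exists>(X :: (nat \<Rightarrow> real) topology) (Y :: (nat \<Rightarrow> real) topology).
            separable_metrizable X \<and> separable_metrizable Y \<and>
            embeds_in Z (compact_open_topology X Y))
          \<longleftrightarrow> aleph0_space Z) \<and>
    (\<forall>(X :: 'b topology) (Y :: 'c topology).
       separable_metrizable X \<and> separable_metrizable Y \<and>
       embeds_in Z (compact_open_topology X Y) \<longrightarrow> aleph0_space Z)"
proof -
  have "regular_space Z" "t1_space Z"
    using assms unfolding Ascoli_space_def by auto
  \<comment> \<open>This fact stays polymorphic in the types of \<open>X\<close> and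
    \<open>Y\<close>, so it serves both for sequences of reals and for arbitrary types.\<close>
  note aleph0 = aleph0_space_if_embeds_in_compact_open[OF this]
  show ?thesis
  proof (intro conjI iffI allI impI)
    show "aleph0_space Z"
      if "\<exists>(X :: (nat \<Rightarrow> real) topology) (Y :: (nat \<Rightarrow> real) topology).
        separable_metrizable X \<and> separable_metrizable Y \<and> embeds_in Z (compact_open_topology X Y)"
      using that by (elim exE conjE) (rule aleph0)
    show "aleph0_space Z"
      if "separable_metrizable X \<and> separable_metrizable Y \<and> embeds_in Z (compact_open_topology X Y)"
      for X :: "'b topology" and Y :: "'c topology"
      using that by (elim conjE) (rule aleph0)
  qed (rule Ascoli_aleph0_space_embeds_in_compact_open[OF assms])
qed

end
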